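(* For $\rho\ge0$ and $N_{\mathrm{mesh}}\ge1$, put $n=2N_{\mathrm{mesh}}$ and let $\mathbf{K}_n^{(2,0)}(\rho)=-\mathbf{B}_n^{(2,0)}+\rho\,\mathbf{M}_n^{(2,0)}\in\mathbb{R}^{n\times n}$ be the matrix defined in the context. If $\rho\in(10,12)\cup(60,+\infty)$, then the condition numbers of $\mathbf{K}_n^{(2,0)}(\rho)$ grow at least exponentially as $n\to\infty$ (there are $c,\alpha>0$, depending on $\rho$, with $\kappa(\mathbf{K}_n^{(2,0)}(\rho))\ge c\,e^{\alpha n}$ for all $n$). If $\rho\in[0,10]\cup[12,60]$, then the growth is at most polynomial (there is $\nu$ with $\kappa(\mathbf{K}_n^{(2,0)}(\rho))=O(n^\nu)$).
   Context: $\mathbf{M}_n^{(2,0)}$ and $\mathbf{B}_n^{(2,0)}$ are the $2N_{\mathrm{mesh}}\times2N_{\mathrm{mesh}}$ block lower triangular block Toeplitz matrices $(M_{i-j})_{i,j=0}^{N_{\mathrm{mesh}}-1}$ and $(B_{i-j})_{i,j=0}^{N_{\mathrm{mesh}}-1}$ with $2\times2$ blocks $$M_0=\tfrac1{30}\begin{pmatrix}3&1\\4&3\end{pmatrix},\ M_1=\tfrac1{30}\begin{pmatrix}3&12\\0&3\end{pmatrix},\ M_2=\tfrac1{30}\begin{pmatrix}0&1\\0&0\end{pmatrix},$$ $$B_0=\tfrac23\begin{pmatrix}-1&-1\\2&-1\end{pmatrix},\ B_1=\tfrac23\begin{pmatrix}-1&4\\0&-1\end{pmatrix},\ B_2=\tfrac23\begin{pmatrix}0&-1\\0&0\end{pmatrix},$$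 all other blocks being zero. (These are the scaled temporal mass and stiffness matrices of quadratic $C^0$ B-splines on a uniform mesh with $N_{\mathrm{mesh}}$ elements.) $\kappa(M)=\|M\|\,\|M^{-1}\|$ in the spectral norm, with $\kappa(M)=\infty$ if $M$ is singular. *)

theory Defs
  imports
    "Jordan_Normal_Form.Gauss_Jordan_Elimination"
    "HOL-Library.Extended_Real"
begin

definition euclidean_norm :: "real vec \<Rightarrow> real" where
  "euclidean_norm v = sqrt (v \<bullet> v)"

text \<open>The operator norm induced by the Euclidean norm. The unit ball is nonempty and its image
  is bounded, so this real-valued supremum is a genuine least upper bound.\<close>

definition spectral_norm :: "real mat \<Rightarrow> real" where
  "spectral_norm A =
     (SUP v \<in> {v \<in> carrier_vec (dim_col A). euclidean_norm v \<le> 1}. euclidean_norm (A *\<^sub>v v))"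

definition condition_number :: "real mat \<Rightarrow> ereal" where
  "condition_number A = (case mat_inverse A of
       None \<Rightarrow> \<infinity>
     | Some A' \<Rightarrow> ereal (spectral_norm A * spectral_norm A'))"

text \<open>The \<open>N \<times> N\<close> block Toeplitz matrix whose \<open>(i, j)\<close> block is the \<open>2 \<times> 2\<close> matrix \<open>T (i - j)\<close>;
  both block indices and entry indices start at 0.\<close>

definition block_toeplitz :: "(int \<Rightarrow> real mat) \<Rightarrow> nat \<Rightarrow> real mat" where
  "block_toeplitz T N = mat (2 * N) (2 * N)
     (\<lambda>(i, j). T (int (i div 2) - int (j div 2)) $$ (i mod 2, j mod 2))"

definition M_block :: "int \<Rightarrow> real mat" where
  "M_block k =
    (if k = 0 then (1 / 30) \<cdot>\<^sub>m mat_of_rows_list 2 [[3, 1], [4, 3]]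
     else if k = 1 then (1 / 30) \<cdot>\<^sub>m mat_of_rows_list 2 [[3, 12], [0, 3]]
     else if k = 2 then (1 / 30) \<cdot>\<^sub>m mat_of_rows_list 2 [[0, 1], [0, 0]]
     else 0\<^sub>m 2 2)"

definition B_block :: "int \<Rightarrow> real mat" where
  "B_block k =
    (if k = 0 then (2 / 3) \<cdot>\<^sub>m mat_of_rows_list 2 [[-1, -1], [2, -1]]
     else if k = 1 then (2 / 3) \<cdot>\<^sub>m mat_of_rows_list 2 [[-1, 4], [0, -1]]
     else if k = 2 then (2 / 3) \<cdot>\<^sub>m mat_of_rows_list 2 [[0, -1], [0, 0]]
     else 0\<^sub>m 2 2)"

text \<open>The parameter \<open>N\<close> is the number of mesh elements; the matrix has order \<open>n = 2 * N\<close>.\<close>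

definition K_mat :: "nat \<Rightarrow> real \<Rightarrow> real mat" where
  "K_mat N \<rho> = - block_toeplitz B_block N + \<rho> \<cdot>\<^sub>m block_toeplitz M_block N"

end

theory Submission
  imports Defs "HOL-Analysis.L2_Norm" "Jordan_Normal_Form.Determinant"
begin

text \<open>
  Block lower triangular block Toeplitz matrices multiply like their symbols \<open>\<Sum> T\<^sub>k z\<^sup>k\<close>, so
  the inverse of \<open>K_mat N \<rho>\<close> is the block Toeplitz matrix of the power series inverse of
  \<open>K(z) = K\<^sub>0 + K\<^sub>1 z + K\<^sub>2 z\<^sup>2\<close>. With \<open>a = 20 + 3\<rho>\<close>, \<open>b = 20 + \<rho>\<close>, \<open>d = 12\<rho> - 80\<close>, \<open>e = 40 - 4\<rho>\<close>
  the symbol \<open>30 K(z)\<close> has rows \<open>(a(1 + z), b + dz + bz\<^sup>2)\<close> and \<open>(-e, a(1 + z))\<close>, hence a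
  palindromic determinant
    \<open>a\<^sup>2(1 + z)\<^sup>2 + e(b + dz + bz\<^sup>2) = 5\<delta>(1 - tz + z\<^sup>2)\<close>, \<open>\<delta> = \<rho>\<^sup>2 + 16\<rho> + 240 > 0\<close>,
    \<open>t = (6\<rho>\<^sup>2 - 208\<rho> + 480)/\<delta>\<close>.
  The coefficients of \<open>1/(1 - tz + z\<^sup>2)\<close> are the Chebyshev values \<open>U\<^sub>k(t/2)\<close>, so the entries of the
  inverse are fixed linear combinations of three consecutive such values
  (\<open>K_mat_mult_inverse\<close>).

  Everything now depends on whether \<open>\<bar>t\<bar>\<close> exceeds 2, that is, on whether the roots of the
  determinant, whose product is 1, leave the unit circle. If \<open>\<bar>t\<bar> > 2\<close> then
  \<open>U\<^sub>k\<close> grows at least like \<open>(\<bar>t\<bar> - 1)\<^sup>k\<close>; if \<open>\<bar>t\<bar> \<le> 2\<close> then \<open>\<bar>U\<^sub>k\<bar> \<le> k + 1\<close>. The thresholds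
  come from \<open>t - 2 = 4\<rho>(\<rho> - 60)/\<delta>\<close> and \<open>t + 2 = 8(\<rho> - 10)(\<rho> - 12)/\<delta>\<close>.

  Passing between entries and spectral norms costs only powers of the order \<open>n\<close>: the norm is at
  least the modulus of each entry and at most \<open>n\<^sup>2\<close> times the largest one. The exponential lower
  bound is read off a single entry of the inverse, \<open>6/\<delta> \<cdot> (40 - 4\<rho>) \<cdot> U\<^bsub>N-1\<^esub>\<close> in the bottom left
  block, whose coefficient vanishes only at \<open>\<rho> = 10\<close>.
\<close>

section \<open>Norm bounds from matrix entries\<close>

lemma euclidean_norm_eq_L2_set: "euclidean_norm v = L2_set (\<lambda>i. v $ i) {..<dim_vec v}"
  by (simp add: euclidean_norm_def L2_set_def scalar_prod_def power2_eq_square atLeast0LessThan)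

lemma abs_component_le_euclidean_norm:
  assumes "i < dim_vec v"
  shows "\<bar>v $ i\<bar> \<le> euclidean_norm v"
proof -
  have "\<bar>v $ i\<bar> \<le> L2_set (\<lambda>i. \<bar>v $ i\<bar>) {..<dim_vec v}"
    using assms by (intro member_le_L2_set) auto
  then show ?thesis by (simp add: euclidean_norm_eq_L2_set L2_set_def)
qed

text \<open>The power of \<open>n\<close> here is crude, but any polynomial factor is harmless for both growth
  statements.\<close>

lemma euclidean_norm_mult_mat_vec_le:
  assumes A: "A \<in> carrier_mat n n"
    and X: "\<And>i j. i < n \<Longrightarrow> j < n \<Longrightarrow> \<bar>A $$ (i, j)\<bar> \<le> X"
    and v: "v \<in> carrier_vec n" "euclidean_norm v \<le> 1"
  shows "euclidean_norm (A *\<^sub>v v) \<le> (real n)\<^sup>2 * X"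
proof -
  have row: "\<bar>(A *\<^sub>v v) $ i\<bar> \<le> real n * X" if i: "i < n" for i
  proof -
    have "\<bar>(A *\<^sub>v v) $ i\<bar> = \<bar>\<Sum>j<n. A $$ (i, j) * v $ j\<bar>"
      using A v i by (simp add: scalar_prod_def atLeast0LessThan)
    also have "\<dots> \<le> (\<Sum>j<n. \<bar>A $$ (i, j) * v $ j\<bar>)"
      by (rule sum_abs)
    also have "\<dots> \<le> (\<Sum>j<n. X)"
    proof (rule sum_mono)
      fix j assume "j \<in> {..<n}"
      then have j: "j < n" by simp
      have "\<bar>v $ j\<bar> \<le> 1"
        using abs_component_le_euclidean_norm[of j v] v j by simp
      then have "\<bar>A $$ (i, j)\<bar> * \<bar>v $ j\<bar> \<le> \<bar>A $$ (i, j)\<bar> * 1"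
        by (intro mult_left_mono) auto
      then show "\<bar>A $$ (i, j) * v $ j\<bar> \<le> X"
        using X[OF i j] by (simp add: abs_mult)
    qed
    finally show ?thesis by simp
  qed
  have "euclidean_norm (A *\<^sub>v v) \<le> (\<Sum>i<n. \<bar>(A *\<^sub>v v) $ i\<bar>)"
    using A L2_set_le_sum_abs[of "\<lambda>i. (A *\<^sub>v v) $ i" "{..<n}"]
    by (simp add: euclidean_norm_eq_L2_set)
  also have "\<dots> \<le> (\<Sum>i<n. real n * X)"
    using row by (intro sum_mono) auto
  finally show ?thesis by (simp add: power2_eq_square)
qed

lemma spectral_norm_le:
  assumes A: "A \<in> carrier_mat n n"
    and X: "\<And>i j. i < n \<Longrightarrow> j < n \<Longrightarrow> \<bar>A $$ (i, j)\<bar> \<le> X"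
  shows "spectral_norm A \<le> (real n)\<^sup>2 * X"
  unfolding spectral_norm_def
proof (rule cSUP_least)
  have "0\<^sub>v n \<in> {v \<in> carrier_vec (dim_col A). euclidean_norm v \<le> 1}"
    using A by (simp add: euclidean_norm_def)
  then show "{v \<in> carrier_vec (dim_col A). euclidean_norm v \<le> 1} \<noteq> {}" by blast
next
  fix v assume "v \<in> {v \<in> carrier_vec (dim_col A). euclidean_norm v \<le> 1}"
  then show "euclidean_norm (A *\<^sub>v v) \<le> (real n)\<^sup>2 * X"
    using A by (intro euclidean_norm_mult_mat_vec_le X) auto
qed

text \<open>The entry is a component of the image of a unit vector. To compare that image with the
  supremum one has to know that the supremum is over a bounded set, which the crude entrywise bound
  provides.\<close>

lemma abs_entry_le_spectral_norm:
  assumes A: "A \<in> carrier_mat n n" and i: "i < n" and j: "j < n"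
  shows "\<bar>A $$ (i, j)\<bar> \<le> spectral_norm A"
proof -
  define X where "X = (\<Sum>p\<in>{..<n} \<times> {..<n}. \<bar>A $$ p\<bar>)"
  have X: "\<bar>A $$ (i, j)\<bar> \<le> X" if "i < n" "j < n" for i j
    using that unfolding X_def by (intro member_le_sum[of "(i, j)" _ "\<lambda>p. \<bar>A $$ p\<bar>"]) auto
  let ?S = "{v \<in> carrier_vec (dim_col A). euclidean_norm v \<le> 1}"
  have "\<bar>A $$ (i, j)\<bar> = \<bar>(A *\<^sub>v unit_vec n j) $ i\<bar>"
    using A i j by simp
  also have "\<dots> \<le> euclidean_norm (A *\<^sub>v unit_vec n j)"
    using A i by (intro abs_component_le_euclidean_norm) simp
  also have "\<dots> \<le> spectral_norm A"
    unfolding spectral_norm_def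
  proof (rule cSUP_upper)
    show "unit_vec n j \<in> ?S"
      using A j by (simp add: euclidean_norm_def)
    show "bdd_above ((\<lambda>v. euclidean_norm (A *\<^sub>v v)) ` ?S)"
      using A by (intro bdd_aboveI2[of _ _ "(real n)\<^sup>2 * X"] euclidean_norm_mult_mat_vec_le X) auto
  qed
  finally show ?thesis .
qed

text \<open>Exhibiting a right inverse settles invertibility and, by uniqueness, identifies the matrix
  returned by Gauss-Jordan elimination.\<close>

lemma condition_number_eq:
  assumes A: "A \<in> carrier_mat n n" and B: "B \<in> carrier_mat n n" and AB: "A * B = 1\<^sub>m n"
  shows "condition_number A = ereal (spectral_norm A * spectral_norm B)"
proof (cases "mat_inverse A")
  case None
  have "B * A = 1\<^sub>m n" by (rule mat_mult_left_right_inverse[OF A B AB])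
  with AB A B have "A \<in> Units (ring_mat TYPE(real) n ())"
    unfolding Units_def ring_mat_def by auto
  with mat_inverse(1)[OF A None, where b = "()"] show ?thesis by blast
next
  case (Some A')
  have A': "A' * A = 1\<^sub>m n" "A' \<in> carrier_mat n n"
    using mat_inverse(2)[OF A Some] by auto
  have "A' = A' * (A * B)" using A' AB by simp
  also have "\<dots> = B" using assoc_mult_mat[OF A'(2) A B] A'(1) B by simp
  finally show ?thesis using Some by (simp add: condition_number_def)
qed

section \<open>Products of banded block Toeplitz matrices\<close>

lemma sum_lessThan_double: "(\<Sum>c<2 * N. f c) = (\<Sum>k<N. f (2 * k) + f (2 * k + 1))"
  for f :: "nat \<Rightarrow> 'a :: comm_monoid_add"
  by (induction N) (auto simp: add.assoc)

text \<open>A scalar entry of a product of truncated Toeplitz matrices is the full convolution of the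
  symbols: the truncation to \<open>k < N\<close> loses nothing, since the left factor being lower triangular
  removes \<open>k > i\<close> and the right one being lower triangular removes the indices \<open>m > i\<close> that the
  right-hand sum contains when the band is wider than the first rows.\<close>

lemma banded_convolution_sum:
  fixes F :: "int \<Rightarrow> int \<Rightarrow> 'a :: comm_monoid_add"
  assumes band: "\<And>m l. m < 0 \<or> int w < m \<or> l < 0 \<Longrightarrow> F m l = 0"
    and i: "i < N"
  shows "(\<Sum>k<N. F (int i - int k) (int k - int j)) = (\<Sum>m\<le>w. F (int m) (int i - int j - int m))"
proof -
  have "(\<Sum>k<N. F (int i - int k) (int k - int j)) = (\<Sum>k\<le>i. F (int i - int k) (int k - int j))"
    using i band by (intro sum.mono_neutral_right) auto
  also have "\<dots> = (\<Sum>m\<le>i. F (int m) (int i - int j - int m))"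
    by (rule sum.reindex_bij_witness[where i = "\<lambda>m. i - m" and j = "\<lambda>k. i - k"])
       (auto simp: of_nat_diff algebra_simps)
  also have "\<dots> = (\<Sum>m\<le>max i w. F (int m) (int i - int j - int m))"
    using band by (intro sum.mono_neutral_left) auto
  also have "\<dots> = (\<Sum>m\<le>w. F (int m) (int i - int j - int m))"
    using band by (intro sum.mono_neutral_right) auto
  finally show ?thesis .
qed

lemma block_toeplitz_carrier [simp]: "block_toeplitz T N \<in> carrier_mat (2 * N) (2 * N)"
  by (simp add: block_toeplitz_def)

lemma index_block_toeplitz:
  "i < 2 * N \<Longrightarrow> j < 2 * N \<Longrightarrow>
    block_toeplitz T N $$ (i, j) = T (int (i div 2) - int (j div 2)) $$ (i mod 2, j mod 2)"
  by (simp add: block_toeplitz_def)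

lemma block_toeplitz_mult_index:
  assumes S: "\<And>m r c. m < 0 \<or> int w < m \<Longrightarrow> r < 2 \<Longrightarrow> c < 2 \<Longrightarrow> S m $$ (r, c) = 0"
    and T: "\<And>l r c. l < 0 \<Longrightarrow> r < 2 \<Longrightarrow> c < 2 \<Longrightarrow> T l $$ (r, c) = 0"
    and ij: "i < 2 * N" "j < 2 * N"
  shows "(block_toeplitz S N * block_toeplitz T N) $$ (i, j) =
    (\<Sum>m\<le>w. let l = int (i div 2) - int (j div 2) - int m in
       S (int m) $$ (i mod 2, 0) * T l $$ (0, j mod 2) +
       S (int m) $$ (i mod 2, 1) * T l $$ (1, j mod 2))"
proof -
  let ?F = "\<lambda>m l. S m $$ (i mod 2, 0) * T l $$ (0, j mod 2) + S m $$ (i mod 2, 1) * T l $$ (1, j mod 2)"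
  have "(block_toeplitz S N * block_toeplitz T N) $$ (i, j) =
      (\<Sum>c<2 * N. block_toeplitz S N $$ (i, c) * block_toeplitz T N $$ (c, j))"
    using ij by (simp add: block_toeplitz_def scalar_prod_def atLeast0LessThan)
  also have "\<dots> = (\<Sum>k<N. ?F (int (i div 2) - int k) (int k - int (j div 2)))"
    unfolding sum_lessThan_double using ij
    by (intro sum.cong) (auto simp: index_block_toeplitz)
  also have "\<dots> = (\<Sum>m\<le>w. ?F (int m) (int (i div 2) - int (j div 2) - int m))"
    using S T ij by (intro banded_convolution_sum) auto
  finally show ?thesis by (simp add: Let_def)
qed

section \<open>A Chebyshev recurrence\<close>

text \<open>This is the Chebyshev polynomial of the second kind at \<open>t/2\<close>, the normalization in which
  \<open>1/(1 - tz + z\<^sup>2)\<close> is its generating function.\<close>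

fun chebyshev_U :: "real \<Rightarrow> nat \<Rightarrow> real" where
  "chebyshev_U t 0 = 1"
| "chebyshev_U t (Suc 0) = t"
| "chebyshev_U t (Suc (Suc k)) = t * chebyshev_U t (Suc k) - chebyshev_U t k"

text \<open>The recurrence step is a linear map of the plane that preserves this quadratic form, so its
  value stays at the initial one. For \<open>\<bar>t\<bar> < 2\<close> the level set is an ellipse.\<close>

lemma chebyshev_U_invariant:
  "(chebyshev_U t (Suc k))\<^sup>2 - t * chebyshev_U t (Suc k) * chebyshev_U t k + (chebyshev_U t k)\<^sup>2 = 1"
  by (induction k) (auto simp: power2_eq_square algebra_simps)

text \<open>Completing the square in the invariant shows that \<open>U\<^sub>k\<^sub>+\<^sub>1\<close> differs from \<open>(t/2) U\<^sub>k\<close> by at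
  most 1, so the modulus grows by at most 1 per step. Unlike a diagonalization, this covers the double
  roots \<open>t = 2\<close> and \<open>t = -2\<close>, where the growth is truly linear.\<close>

lemma chebyshev_U_linear_bound:
  assumes t: "\<bar>t\<bar> \<le> 2"
  shows "\<bar>chebyshev_U t k\<bar> \<le> real k + 1"
proof (induction k)
  case (Suc k)
  define x where "x = chebyshev_U t (Suc k)"
  define y where "y = chebyshev_U t k"
  have t2: "(t / 2)\<^sup>2 \<le> 1" using t by (subst abs_square_le_1) auto
  have "(x - t / 2 * y)\<^sup>2 = 1 - (1 - (t / 2)\<^sup>2) * y\<^sup>2"
    using chebyshev_U_invariant[of t k, folded x_def y_def]
    by (simp add: power2_eq_square field_simps)
  also have "\<dots> \<le> 1" using t2 by simp
  finally have "\<bar>x - t / 2 * y\<bar> \<le> 1" by (simp add: abs_square_le_1)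
  moreover have "\<bar>t / 2 * y\<bar> \<le> 1 * \<bar>y\<bar>"
    unfolding abs_mult using t by (intro mult_right_mono) auto
  ultimately show ?case using Suc by (simp flip: x_def y_def)
qed simp

text \<open>Once the moduli are nondecreasing, \<open>\<bar>t U\<^sub>k\<^sub>+\<^sub>1 - U\<^sub>k\<bar> \<ge> (\<bar>t\<bar> - 1) \<bar>U\<^sub>k\<^sub>+\<^sub>1\<bar>\<close>, which in turn keeps
  them nondecreasing. The rate is below the dominant root of the characteristic equation but
  exceeds 1.\<close>

lemma chebyshev_U_growth:
  assumes t: "\<bar>t\<bar> > 2"
  shows "\<bar>chebyshev_U t k\<bar> \<ge> (\<bar>t\<bar> - 1) ^ k"
proof -
  have step: "\<bar>chebyshev_U t (Suc k)\<bar> \<ge> (\<bar>t\<bar> - 1) * \<bar>chebyshev_U t k\<bar>" for k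
  proof (induction k)
    case (Suc k)
    have "1 * \<bar>chebyshev_U t k\<bar> \<le> (\<bar>t\<bar> - 1) * \<bar>chebyshev_U t k\<bar>"
      using t by (intro mult_right_mono) auto
    then have "\<bar>chebyshev_U t k\<bar> \<le> \<bar>chebyshev_U t (Suc k)\<bar>" using Suc by simp
    moreover have "\<bar>t * chebyshev_U t (Suc k)\<bar> - \<bar>chebyshev_U t k\<bar> \<le> \<bar>chebyshev_U t (Suc (Suc k))\<bar>"
      by simp
    ultimately show ?case by (simp add: abs_mult algebra_simps)
  qed simp
  show ?thesis
  proof (induction k)
    case (Suc k)
    have "(\<bar>t\<bar> - 1) * (\<bar>t\<bar> - 1) ^ k \<le> (\<bar>t\<bar> - 1) * \<bar>chebyshev_U t k\<bar>"
      using t Suc by (intro mult_left_mono) auto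
    then show ?case using step[of k] by simp
  qed simp
qed

text \<open>Extending by zero to negative indices lets the three-term recurrence hold for all integers
  with a unit impulse at 0, which is the coefficientwise form of \<open>(1 - tz + z\<^sup>2) \<Sum> U\<^sub>k z\<^sup>k = 1\<close>; the
  first rows of the matrix then need no separate treatment.\<close>

definition chebyshev_U_int :: "real \<Rightarrow> int \<Rightarrow> real" where
  "chebyshev_U_int t k = (if k < 0 then 0 else chebyshev_U t (nat k))"

lemma chebyshev_U_int_generating_recurrence:
  "chebyshev_U_int t k - t * chebyshev_U_int t (k - 1) + chebyshev_U_int t (k - 2) =
    (if k = 0 then 1 else 0)"
proof -
  consider "k < 0" | "k = 0" | "k = 1" | l where "k = int (Suc (Suc l))"
    by (metis One_nat_def int_nat_eq linorder_not_less nat_0_iff nat_1_add_1 not0_implies_Suc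
        of_nat_0 of_nat_1)
  then show ?thesis
  proof cases
    case (4 l)
    have "nat k = Suc (Suc l)" "nat (k - 1) = Suc l" "nat (k - 2) = l" using 4 by auto
    then show ?thesis using 4 by (simp add: chebyshev_U_int_def)
  qed (auto simp: chebyshev_U_int_def)
qed

section \<open>The symbol and the inverse matrix\<close>

definition K_block :: "real \<Rightarrow> int \<Rightarrow> real mat" where
  "K_block \<rho> k = - B_block k + \<rho> \<cdot>\<^sub>m M_block k"

text \<open>The determinant of the symbol \<open>\<Sum> K_block \<rho> k z\<^sup>k\<close> is \<open>(\<delta>/180)(1 - tz + z\<^sup>2)\<close>, where \<open>\<delta>\<close> and
  \<open>t\<close> are the two quantities defined next.\<close>

definition det_coeff :: "real \<Rightarrow> real" where
  "det_coeff \<rho> = \<rho>\<^sup>2 + 16 * \<rho> + 240"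

definition cheb_param :: "real \<Rightarrow> real" where
  "cheb_param \<rho> = (6 * \<rho>\<^sup>2 - 208 * \<rho> + 480) / det_coeff \<rho>"

text \<open>The coefficient of \<open>z\<^sup>k\<close> in the adjugate of the symbol divided by its determinant. The factor
  is \<open>180/\<delta>\<close> divided by the common denominator 30 of the adjugate.\<close>

definition inverse_block :: "real \<Rightarrow> int \<Rightarrow> real mat" where
  "inverse_block \<rho> k = (let u = chebyshev_U_int (cheb_param \<rho>) in
     (6 / det_coeff \<rho>) \<cdot>\<^sub>m mat_of_rows_list 2
       [[(20 + 3 * \<rho>) * (u k + u (k - 1)),
         - ((20 + \<rho>) * u k + (12 * \<rho> - 80) * u (k - 1) + (20 + \<rho>) * u (k - 2))],
        [(40 - 4 * \<rho>) * u k,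
         (20 + 3 * \<rho>) * (u k + u (k - 1))]])"

lemma K_mat_eq: "K_mat N \<rho> = block_toeplitz (K_block \<rho>) N"
  by (rule eq_matI)
     (auto simp: K_mat_def block_toeplitz_def K_block_def M_block_def B_block_def mat_of_rows_list_def)

lemma index_K_block:
  "K_block \<rho> k $$ (0, 0) = (if k = 0 \<or> k = 1 then (20 + 3 * \<rho>) / 30 else 0)"
  "K_block \<rho> k $$ (0, Suc 0) =
     (if k = 0 \<or> k = 2 then (20 + \<rho>) / 30 else if k = 1 then (12 * \<rho> - 80) / 30 else 0)"
  "K_block \<rho> k $$ (Suc 0, 0) = (if k = 0 then (4 * \<rho> - 40) / 30 else 0)"
  "K_block \<rho> k $$ (Suc 0, Suc 0) = (if k = 0 \<or> k = 1 then (20 + 3 * \<rho>) / 30 else 0)"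
  by (auto simp: K_block_def M_block_def B_block_def mat_of_rows_list_def field_simps)

lemma index_inverse_block:
  fixes \<rho> k
  defines "u \<equiv> chebyshev_U_int (cheb_param \<rho>)"
  shows "inverse_block \<rho> k $$ (0, 0) = 6 / det_coeff \<rho> * ((20 + 3 * \<rho>) * (u k + u (k - 1)))"
    "inverse_block \<rho> k $$ (0, Suc 0) = - (6 / det_coeff \<rho> *
       ((20 + \<rho>) * u k + (12 * \<rho> - 80) * u (k - 1) + (20 + \<rho>) * u (k - 2)))"
    "inverse_block \<rho> k $$ (Suc 0, 0) = 6 / det_coeff \<rho> * ((40 - 4 * \<rho>) * u k)"
    "inverse_block \<rho> k $$ (Suc 0, Suc 0) = 6 / det_coeff \<rho> * ((20 + 3 * \<rho>) * (u k + u (k - 1)))"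
  by (auto simp: inverse_block_def Let_def u_def mat_of_rows_list_def minus_divide_left)

lemma det_coeff_pos: "\<rho> \<ge> 0 \<Longrightarrow> det_coeff \<rho> > 0"
  by (simp add: det_coeff_def add_nonneg_pos)

text \<open>This is \<open>K(z) K(z)\<^sup>-\<^sup>1 = 1\<close> coefficientwise. The off-diagonal entries cancel as polynomials in
  the adjugate identity; on the diagonal the determinant meets its Chebyshev expansion, and the
  recurrence leaves only the impulse at \<open>k = 0\<close>.\<close>

lemma block_convolution:
  assumes \<rho>: "\<rho> \<ge> 0" and rs: "r < 2" "s < 2"
  shows "(\<Sum>m\<le>2. let l = k - int m in
       K_block \<rho> (int m) $$ (r, 0) * inverse_block \<rho> l $$ (0, s) +
       K_block \<rho> (int m) $$ (r, 1) * inverse_block \<rho> l $$ (1, s)) =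
     (if k = 0 \<and> r = s then 1 else 0)"
proof -
  define u where "u = chebyshev_U_int (cheb_param \<rho>)"
  define p where "p = det_coeff \<rho>"
  have p: "p > 0" using det_coeff_pos[OF \<rho>] by (simp add: p_def)
  have "6 * \<rho>\<^sup>2 - 208 * \<rho> + 480 = p * cheb_param \<rho>"
    using p by (simp add: cheb_param_def p_def)
  moreover have "p * (u k - cheb_param \<rho> * u (k - 1) + u (k - 2)) = (if k = 0 then p else 0)"
    unfolding u_def chebyshev_U_int_generating_recurrence by simp
  ultimately have rec: "p * u k - (6 * \<rho>\<^sup>2 - 208 * \<rho> + 480) * u (k - 1) + p * u (k - 2) =
      (if k = 0 then p else 0)"
    by (simp add: algebra_simps)
  have det: "(20 + 3 * \<rho>)\<^sup>2 * (u k + 2 * u (k - 1) + u (k - 2)) +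
      (40 - 4 * \<rho>) * ((20 + \<rho>) * u k + (12 * \<rho> - 80) * u (k - 1) + (20 + \<rho>) * u (k - 2)) =
      5 * (if k = 0 then p else 0)"
    unfolding rec[symmetric] by (simp add: p_def det_coeff_def power2_eq_square algebra_simps)
  \<comment> \<open>With the coefficients opaque, the entries of the product differ from the determinant
    identity only by commutative ring laws.\<close>
  define a where "a = 20 + 3 * \<rho>"
  define b where "b = 20 + \<rho>"
  define d where "d = 12 * \<rho> - 80"
  define e where "e = 40 - 4 * \<rho>"
  define g where "g = 6 / p"
  have g: "g * p = 6" using p by (simp add: g_def)
  have diag: "g * (a\<^sup>2 * (u k + 2 * u (k - 1) + u (k - 2)) + e * (b * u k + d * u (k - 1) + b * u (k - 2))) =
      (if k = 0 then 30 else 0)"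
    unfolding a_def b_def d_def e_def det using g by simp
  have diff: "k - 1 - 1 = k - 2" "k - 1 - 2 = k - 3" "k - 2 - 1 = k - 3" "k - 2 - 2 = k - 4" by auto
  have e': "4 * \<rho> - 40 = - e" by (simp add: e_def)
  note K = index_K_block[of \<rho>, unfolded e', folded a_def b_def d_def]
  note I = index_inverse_block[of \<rho>, folded u_def p_def, folded a_def b_def d_def e_def g_def]
  have three: "(\<Sum>m\<le>2. f m) = f 0 + f 1 + f 2" for f :: "nat \<Rightarrow> real"
    by (simp add: numeral_2_eq_2)
  consider "r = 0" "s = 0" | "r = 0" "s = 1" | "r = 1" "s = 0" | "r = 1" "s = 1"
    using rs by linarith
  then show ?thesis
  proof cases
    case 1
    then show ?thesis using diag
      by (simp add: three Let_def K I diff power2_eq_square field_simps split: if_splits)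
  next
    case 2
    then show ?thesis
      by (simp add: three Let_def K I diff field_simps)
  next
    case 3
    then show ?thesis
      by (simp add: three Let_def K I diff field_simps)
  next
    case 4
    then show ?thesis using diag
      by (simp add: three Let_def K I diff power2_eq_square field_simps split: if_splits)
  qed
qed

lemma K_block_band:
  assumes "m < 0 \<or> int 2 < m" "r < 2" "c < 2"
  shows "K_block \<rho> m $$ (r, c) = 0"
proof -
  have "r = 0 \<or> r = Suc 0" "c = 0 \<or> c = Suc 0" using assms by auto
  then show ?thesis using assms(1) by (auto simp: index_K_block)
qed

lemma inverse_block_causal:
  assumes "l < 0" "r < 2" "c < 2"
  shows "inverse_block \<rho> l $$ (r, c) = 0"
proof -
  have "r = 0 \<or> r = Suc 0" "c = 0 \<or> c = Suc 0" using assms by auto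
  then show ?thesis using assms(1) by (auto simp: index_inverse_block chebyshev_U_int_def)
qed

lemma K_mat_mult_inverse:
  assumes "\<rho> \<ge> 0"
  shows "K_mat N \<rho> * block_toeplitz (inverse_block \<rho>) N = 1\<^sub>m (2 * N)"
proof (rule eq_matI)
  fix i j assume "i < dim_row (1\<^sub>m (2 * N) :: real mat)" "j < dim_col (1\<^sub>m (2 * N) :: real mat)"
  then have ij: "i < 2 * N" "j < 2 * N" by auto
  have "(K_mat N \<rho> * block_toeplitz (inverse_block \<rho>) N) $$ (i, j) =
      (if int (i div 2) - int (j div 2) = 0 \<and> i mod 2 = j mod 2 then 1 else 0)"
    unfolding K_mat_eq
    by (subst block_toeplitz_mult_index[OF K_block_band inverse_block_causal ij])
       (auto simp only: block_convolution[OF assms mod_less_divisor mod_less_divisor] pos2)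
  also have "int (i div 2) - int (j div 2) = 0 \<and> i mod 2 = j mod 2 \<longleftrightarrow> i = j"
    by (metis diff_self div_mult_mod_eq eq_iff_diff_eq_0 of_nat_eq_iff)
  finally show "(K_mat N \<rho> * block_toeplitz (inverse_block \<rho>) N) $$ (i, j) = 1\<^sub>m (2 * N) $$ (i, j)"
    using ij by simp
qed (simp_all add: K_mat_eq block_toeplitz_def)

lemma condition_number_K_mat:
  assumes "\<rho> \<ge> 0"
  shows "condition_number (K_mat N \<rho>) =
    ereal (spectral_norm (K_mat N \<rho>) * spectral_norm (block_toeplitz (inverse_block \<rho>) N))"
  by (rule condition_number_eq[OF _ _ K_mat_mult_inverse[OF assms]]) (simp_all add: K_mat_eq)

section \<open>The two growth regimes\<close>

lemma cheb_param_offsets: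
  assumes "\<rho> \<ge> 0"
  shows "cheb_param \<rho> - 2 = 4 * \<rho> * (\<rho> - 60) / det_coeff \<rho>"
    and "cheb_param \<rho> + 2 = 8 * ((\<rho> - 10) * (\<rho> - 12)) / det_coeff \<rho>"
  using det_coeff_pos[OF assms]
  by (simp_all add: cheb_param_def field_simps)
     (simp_all add: det_coeff_def power2_eq_square algebra_simps)

lemma abs_cheb_param_gt_2:
  assumes "\<rho> \<in> {10<..<12} \<union> {60<..}"
  shows "\<bar>cheb_param \<rho>\<bar> > 2"
proof -
  have \<rho>: "\<rho> \<ge> 0" using assms by auto
  note p = det_coeff_pos[OF \<rho>]
  show ?thesis
  proof (cases "\<rho> > 60")
    case True
    then have "cheb_param \<rho> - 2 > 0"
      unfolding cheb_param_offsets[OF \<rho>] using p by simp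
    then show ?thesis by simp
  next
    case False
    then have "(\<rho> - 10) * (\<rho> - 12) < 0" using assms by (intro mult_pos_neg) auto
    then have "cheb_param \<rho> + 2 < 0"
      unfolding cheb_param_offsets[OF \<rho>] using p by (intro divide_neg_pos mult_pos_neg[of 8]) auto
    then show ?thesis by simp
  qed
qed

lemma abs_cheb_param_le_2:
  assumes \<rho>: "\<rho> \<in> {0..10} \<union> {12..60}"
  shows "\<bar>cheb_param \<rho>\<bar> \<le> 2"
proof -
  have \<rho>0: "\<rho> \<ge> 0" using assms by auto
  note p = det_coeff_pos[OF \<rho>0]
  have "\<rho> * (\<rho> - 60) \<le> 0" using \<rho> by (intro mult_nonneg_nonpos) auto
  then have "cheb_param \<rho> - 2 \<le> 0"
    unfolding cheb_param_offsets[OF \<rho>0] using p by (simp add: divide_nonpos_pos mult.assoc)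
  moreover have "(\<rho> - 10) * (\<rho> - 12) \<ge> 0"
    using \<rho> by (auto intro: mult_nonneg_nonneg mult_nonpos_nonpos)
  then have "cheb_param \<rho> + 2 \<ge> 0"
    unfolding cheb_param_offsets[OF \<rho>0] using p by (intro divide_nonneg_pos mult_nonneg_nonneg[of 8]) auto
  ultimately show ?thesis by simp
qed

text \<open>Only two entries are needed: the top left entry of the matrix, which does not depend on \<open>N\<close>,
  and the lower left entry of the bottom left block of the inverse, which is a nonzero multiple of
  \<open>U\<^bsub>N-1\<^esub>\<close>.\<close>

lemma condition_number_exponential_lower:
  assumes \<rho>: "\<rho> \<in> {10<..<12} \<union> {60<..}"
  shows "\<exists>c>0. \<exists>\<alpha>>0. \<forall>N\<ge>1. condition_number (K_mat N \<rho>) \<ge> ereal (c * exp (\<alpha> * real (2 * N)))"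
proof -
  have \<rho>0: "\<rho> \<ge> 0" and e0: "40 - 4 * \<rho> \<noteq> 0" using \<rho> by auto
  note p = det_coeff_pos[OF \<rho>0]
  define L where "L = \<bar>cheb_param \<rho>\<bar> - 1"
  have L: "L > 1" using abs_cheb_param_gt_2[OF \<rho>] by (simp add: L_def)
  \<comment> \<open>The product of the moduli of the two entries, without the Chebyshev factor.\<close>
  define g where "g = (20 + 3 * \<rho>) / 30 * (6 / det_coeff \<rho> * \<bar>40 - 4 * \<rho>\<bar>)"
  have g: "g > 0" unfolding g_def using \<rho>0 e0 p by (intro mult_pos_pos divide_pos_pos) auto
  have bound: "g / L * exp (ln L / 2 * real (2 * N)) \<le>
      spectral_norm (K_mat N \<rho>) * spectral_norm (block_toeplitz (inverse_block \<rho>) N)" if N: "N \<ge> 1" for N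
  proof -
    \<comment> \<open>The division by \<open>L\<close> makes up for the index \<open>N - 1\<close> of the last block, and halving \<open>ln L\<close>
      for the order being \<open>2 N\<close>.\<close>
    have "g / L * exp (ln L / 2 * real (2 * N)) = g * L ^ (N - 1)"
    proof -
      have "exp (ln L / 2 * real (2 * N)) = L ^ N"
        using L by (simp add: exp_of_nat_mult mult.commute[of _ "real N"])
      also have "\<dots> = L * L ^ (N - 1)" using N by (cases N) auto
      finally show ?thesis using L by simp
    qed
    also have "\<dots> \<le> g * \<bar>chebyshev_U (cheb_param \<rho>) (N - 1)\<bar>"
      unfolding L_def using g abs_cheb_param_gt_2[OF \<rho>]
      by (intro mult_left_mono chebyshev_U_growth) auto
    also have "\<dots> = \<bar>K_mat N \<rho> $$ (0, 0)\<bar> * \<bar>block_toeplitz (inverse_block \<rho>) N $$ (2 * N - 1, 0)\<bar>"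
    proof -
      have "(2 * N - 1) div 2 = N - 1" "(2 * N - 1) mod 2 = Suc 0"
        using N by (auto, presburger)
      moreover have "nat (int (N - 1)) = N - 1" by simp
      ultimately show ?thesis
        using N \<rho>0 p by (simp add: K_mat_eq index_block_toeplitz index_K_block index_inverse_block
            chebyshev_U_int_def g_def abs_mult)
    qed
    also have "\<dots> \<le> spectral_norm (K_mat N \<rho>) * spectral_norm (block_toeplitz (inverse_block \<rho>) N)"
      unfolding K_mat_eq using N
      by (intro mult_mono' abs_entry_le_spectral_norm[where n = "2 * N"]) auto
    finally show ?thesis .
  qed
  have "g / L > 0" "ln L / 2 > 0" using g L by auto
  then show ?thesis
    using bound unfolding condition_number_K_mat[OF \<rho>0] ereal_less_eq by blast
qed

lemma abs_K_mat_entry_le: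
  assumes "\<rho> \<ge> 0" "i < 2 * N" "j < 2 * N"
  shows "\<bar>K_mat N \<rho> $$ (i, j)\<bar> \<le> 4 + \<rho>"
proof -
  have "i mod 2 = 0 \<or> i mod 2 = Suc 0" "j mod 2 = 0 \<or> j mod 2 = Suc 0" by auto
  then show ?thesis using assms
    by (auto simp: K_mat_eq index_block_toeplitz index_K_block abs_le_iff field_simps)
qed

text \<open>Block indices run up to \<open>N - 1\<close>, so every Chebyshev value involved is at most \<open>N\<close> in modulus;
  the constant \<open>120 + 14\<rho>\<close> is a common bound for the sums of the moduli of the coefficients in each
  entry of the adjugate.\<close>

lemma abs_inverse_entry_le:
  assumes \<rho>: "\<rho> \<in> {0..10} \<union> {12..60}" and ij: "i < 2 * N" "j < 2 * N"
  shows "\<bar>block_toeplitz (inverse_block \<rho>) N $$ (i, j)\<bar> \<le> 6 / det_coeff \<rho> * (120 + 14 * \<rho>) * real N"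
proof -
  have \<rho>0: "\<rho> \<ge> 0" using assms by auto
  note p = det_coeff_pos[OF \<rho>0]
  define u where "u = chebyshev_U_int (cheb_param \<rho>)"
  define k where "k = int (i div 2) - int (j div 2)"
  have u: "\<bar>u l\<bar> \<le> real N" if "l \<le> k" for l
  proof (cases "l < 0")
    case False
    have "\<bar>u l\<bar> \<le> real (nat l) + 1"
      using False chebyshev_U_linear_bound[OF abs_cheb_param_le_2[OF \<rho>], of "nat l"]
      by (simp add: u_def chebyshev_U_int_def)
    also have "nat l + 1 \<le> N" using False that ij unfolding k_def by linarith
    then have "real (nat l) + 1 \<le> real N" by linarith
    finally show ?thesis .
  qed (simp add: u_def chebyshev_U_int_def)
  have scaled: "\<bar>x * u l\<bar> \<le> \<bar>x\<bar> * real N" if "l \<le> k" for x l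
    unfolding abs_mult using u[OF that] by (intro mult_left_mono) auto
  have scale: "\<bar>6 / det_coeff \<rho> * x\<bar> \<le> 6 / det_coeff \<rho> * (120 + 14 * \<rho>) * real N"
    if "\<bar>x\<bar> \<le> (120 + 14 * \<rho>) * real N" for x
  proof -
    have "6 / det_coeff \<rho> * \<bar>x\<bar> \<le> 6 / det_coeff \<rho> * ((120 + 14 * \<rho>) * real N)"
      using p that by (intro mult_left_mono) auto
    moreover have "\<bar>6 / det_coeff \<rho> * x\<bar> = 6 / det_coeff \<rho> * \<bar>x\<bar>" using p by (simp add: abs_mult)
    ultimately show ?thesis by (simp only: mult.assoc)
  qed
  have widen: "c * real N \<le> (120 + 14 * \<rho>) * real N" if "c \<le> 120 + 14 * \<rho>" for c
    using that by (intro mult_right_mono) auto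
  have a: "\<bar>(20 + 3 * \<rho>) * (u k + u (k - 1))\<bar> \<le> (120 + 14 * \<rho>) * real N"
  proof -
    have "\<bar>(20 + 3 * \<rho>) * (u k + u (k - 1))\<bar> \<le> (2 * \<bar>20 + 3 * \<rho>\<bar>) * real N"
      using scaled[of k "20 + 3 * \<rho>"] scaled[of "k - 1" "20 + 3 * \<rho>"] by (simp add: distrib_left)
    also have "\<dots> \<le> (120 + 14 * \<rho>) * real N" using \<rho>0 by (intro widen) auto
    finally show ?thesis .
  qed
  have b: "\<bar>(20 + \<rho>) * u k + (12 * \<rho> - 80) * u (k - 1) + (20 + \<rho>) * u (k - 2)\<bar> \<le> (120 + 14 * \<rho>) * real N"
  proof -
    have "\<bar>(20 + \<rho>) * u k + (12 * \<rho> - 80) * u (k - 1) + (20 + \<rho>) * u (k - 2)\<bar>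
        \<le> (2 * \<bar>20 + \<rho>\<bar> + \<bar>12 * \<rho> - 80\<bar>) * real N"
      using scaled[of k "20 + \<rho>"] scaled[of "k - 1" "12 * \<rho> - 80"] scaled[of "k - 2" "20 + \<rho>"]
      by (simp add: distrib_right)
    also have "\<dots> \<le> (120 + 14 * \<rho>) * real N" using \<rho>0 by (intro widen) auto
    finally show ?thesis .
  qed
  have e: "\<bar>(40 - 4 * \<rho>) * u k\<bar> \<le> (120 + 14 * \<rho>) * real N"
  proof -
    have "\<bar>(40 - 4 * \<rho>) * u k\<bar> \<le> \<bar>40 - 4 * \<rho>\<bar> * real N" by (rule scaled) simp
    also have "\<dots> \<le> (120 + 14 * \<rho>) * real N" using \<rho>0 by (intro widen) auto
    finally show ?thesis .
  qed
  have "i mod 2 = 0 \<or> i mod 2 = Suc 0" "j mod 2 = 0 \<or> j mod 2 = Suc 0" by auto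
  then show ?thesis
    unfolding index_block_toeplitz[OF ij] k_def[symmetric]
    using scale[OF a] scale[OF b] scale[OF e]
    by (elim disjE) (simp_all only: index_inverse_block abs_minus_cancel flip: u_def)
qed

text \<open>The exponent is \<open>2 + 2 + 1\<close>: two for each passage from entries to the spectral norm and one
  for the linear growth of the entries of the inverse.\<close>

lemma condition_number_polynomial_upper:
  assumes \<rho>: "\<rho> \<in> {0..10} \<union> {12..60}"
  shows "\<exists>C. \<forall>N\<ge>1. condition_number (K_mat N \<rho>) \<le> ereal (C * real (2 * N) powr 5)"
proof -
  have \<rho>0: "\<rho> \<ge> 0" using assms by auto
  note p = det_coeff_pos[OF \<rho>0]
  define D where "D = 6 / det_coeff \<rho> * (120 + 14 * \<rho>)"
  have D: "D \<ge> 0" using \<rho>0 p by (simp add: D_def)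
  have bound: "spectral_norm (K_mat N \<rho>) * spectral_norm (block_toeplitz (inverse_block \<rho>) N)
      \<le> (4 + \<rho>) * D / 2 * real (2 * N) powr 5" if N: "N \<ge> 1" for N
  proof -
    have "\<bar>block_toeplitz (inverse_block \<rho>) N $$ (0, 0)\<bar> \<le> spectral_norm (block_toeplitz (inverse_block \<rho>) N)"
      using N by (intro abs_entry_le_spectral_norm[where n = "2 * N"]) auto
    then have nonneg: "0 \<le> spectral_norm (block_toeplitz (inverse_block \<rho>) N)" by linarith
    have "spectral_norm (K_mat N \<rho>) \<le> (real (2 * N))\<^sup>2 * (4 + \<rho>)"
      using abs_K_mat_entry_le[OF \<rho>0] by (intro spectral_norm_le) (auto simp: K_mat_eq)
    moreover have "spectral_norm (block_toeplitz (inverse_block \<rho>) N) \<le> (real (2 * N))\<^sup>2 * (D * real N)"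
      using abs_inverse_entry_le[OF \<rho>] unfolding D_def by (intro spectral_norm_le) auto
    ultimately have "spectral_norm (K_mat N \<rho>) * spectral_norm (block_toeplitz (inverse_block \<rho>) N)
        \<le> ((real (2 * N))\<^sup>2 * (4 + \<rho>)) * ((real (2 * N))\<^sup>2 * (D * real N))"
      using nonneg \<rho>0 by (intro mult_mono) auto
    also have "\<dots> = (4 + \<rho>) * D / 2 * real (2 * N) ^ 5"
      by (simp add: eval_nat_numeral)
    also have "\<dots> = (4 + \<rho>) * D / 2 * real (2 * N) powr 5"
      using N by simp
    finally show ?thesis .
  qed
  then show ?thesis
    unfolding condition_number_K_mat[OF \<rho>0] ereal_less_eq by blast
qed

theorem corollary5p3:
  fixes \<rho> :: real
  assumes "\<rho> \<ge> 0"
  shows "(\<rho> \<in> {10<..<12} \<union> {60<..} \<longrightarrow>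
            (\<exists>c>0. \<exists>\<alpha>>0. \<forall>N\<ge>1.
               condition_number (K_mat N \<rho>) \<ge> ereal (c * exp (\<alpha> * real (2 * N))))) \<and>
         (\<rho> \<in> {0..10} \<union> {12..60} \<longrightarrow>
            (\<exists>\<nu>::real. \<exists>C::real. \<forall>\<^sub>F N in sequentially.
               condition_number (K_mat N \<rho>) \<le> ereal (C * real (2 * N) powr \<nu>)))"
  using condition_number_exponential_lower condition_number_polynomial_upper
  unfolding eventually_sequentially by blast

end
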